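(* Assume (A2), (A3), $\rho<0$, and that the tail-index satisfies $\alpha>1$. Let $\nu_k$ and $\nu_\infty$ denote the laws of $x_k$ and of the stationary solution $x_\infty$, and let $1\le p<\alpha$ with $\nu_0$ having finite $p$-th moment. Then $h(p)^{1/p}\in(0,1)$ and for all $k\ge0$ $$\mathcal{W}_p(\nu_k,\nu_\infty)\le (h(p))^{k/p}\,\mathcal{W}_p(\nu_0,\nu_\infty).$$
   Context: Setup: integers $d,b\ge1$, stepsize $\eta>0$, i.i.d. data $(a_i,y_i)$; $H_k=\sum_{i=b(k-1)+1}^{bk}a_ia_i^T$, $M_k=I_d-\frac{\eta}{b}H_k$, $q_k=\frac{\eta}{b}\sum_{i=b(k-1)+1}^{bk}a_iy_i$, $x_k=M_kx_{k-1}+q_k$ with $x_0$ independent of the data. $\|\cdot\|$ Euclidean/spectral norm. $\Pi_k=M_k\cdots M_1$, $h(s)=\lim_{k\to\infty}(\mathbb{E}\|\Pi_k\|^s)^{1/k}$, $\rho=\lim_{k\to\infty}(2k)^{-1}\log\lambda_{\max}(\Pi_k^T\Pi_k)$. Tail-index $\alpha$: unique $\alpha>0$ with $h(\alpha)=1$. $\mathcal{W}_p(\nu_1,\nu_2)=(\inf\mathbb{E}\|Z_1-Z_2\|^p)^{1/p}$, infimum over couplings of $\nu_1,\nu_2$ (probability measures on $\mathbb{R}^d$ with finite $p$-th moment). Assumptions: (A2) $y_i$ i.i.d. with continuous density supported on $\mathbb{R}$, all moments finite. (A3) $a_i\sim\mathcal{N}(0,\sigma^2I_d)$ i.i.d.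 *)

theory Defs
  imports "HOL-Probability.Probability"
begin

definition outer :: "real^'d \<Rightarrow> real^'d \<Rightarrow> real^'d^'d" where
  "outer u v = (\<chi> i j. u $ i * v $ j)"

definition batch :: "nat \<Rightarrow> nat \<Rightarrow> nat set" where
  "batch b k = {b * (k - 1) + 1 .. b * k}"

text \<open>H_k, M_k, q_k for one sample path of the data (a_i)_i, (y_i)_i.\<close>
definition Hmat :: "nat \<Rightarrow> (nat \<Rightarrow> real^'d) \<Rightarrow> nat \<Rightarrow> real^'d^'d" where
  "Hmat b a k = (\<Sum>i\<in>batch b k. outer (a i) (a i))"

definition Mmat :: "real \<Rightarrow> nat \<Rightarrow> (nat \<Rightarrow> real^'d) \<Rightarrow> nat \<Rightarrow> real^'d^'d" where
  "Mmat \<eta> b a k = mat 1 - (\<eta> / real b) *\<^sub>R Hmat b a k"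

definition qvec :: "real \<Rightarrow> nat \<Rightarrow> (nat \<Rightarrow> real^'d) \<Rightarrow> (nat \<Rightarrow> real) \<Rightarrow> nat \<Rightarrow> real^'d" where
  "qvec \<eta> b a y k = (\<eta> / real b) *\<^sub>R (\<Sum>i\<in>batch b k. y i *\<^sub>R a i)"

fun xseq :: "real \<Rightarrow> nat \<Rightarrow> (nat \<Rightarrow> real^'d) \<Rightarrow> (nat \<Rightarrow> real) \<Rightarrow> real^'d \<Rightarrow> nat \<Rightarrow> real^'d" where
  "xseq \<eta> b a y x0 0 = x0"
| "xseq \<eta> b a y x0 (Suc k) = Mmat \<eta> b a (Suc k) *v xseq \<eta> b a y x0 k + qvec \<eta> b a y (Suc k)"

fun Piprod :: "real \<Rightarrow> nat \<Rightarrow> (nat \<Rightarrow> real^'d) \<Rightarrow> nat \<Rightarrow> real^'d^'d" where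
  "Piprod \<eta> b a 0 = mat 1"
| "Piprod \<eta> b a (Suc k) = Mmat \<eta> b a (Suc k) ** Piprod \<eta> b a k"

definition spec_norm :: "real^'d^'d \<Rightarrow> real" where
  "spec_norm A = onorm (\<lambda>v. A *v v)"

definition lambda_max :: "real^'d^'d \<Rightarrow> real" where
  "lambda_max A = Sup {l. \<exists>v. v \<noteq> 0 \<and> A *v v = l *\<^sub>R v}"

definition hfun :: "'w measure \<Rightarrow> real \<Rightarrow> nat \<Rightarrow> (nat \<Rightarrow> 'w \<Rightarrow> real^'d) \<Rightarrow> real \<Rightarrow> real" where
  "hfun M \<eta> b a s =
     lim (\<lambda>k. (\<integral>\<omega>. spec_norm (Piprod \<eta> b (\<lambda>i. a i \<omega>) k) powr s \<partial>M) powr (1 / real k))"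

text \<open>A probability law nu on R^d is stationary for the recursion x_k = M_k x_{k-1} + q_k:
  if X ~ nu is independent of (M_1, q_1), then M_1 X + q_1 ~ nu.\<close>
definition stationary_law ::
  "'w measure \<Rightarrow> real \<Rightarrow> nat \<Rightarrow> (nat \<Rightarrow> 'w \<Rightarrow> real^'d) \<Rightarrow> (nat \<Rightarrow> 'w \<Rightarrow> real) \<Rightarrow> (real^'d) measure \<Rightarrow> bool" where
  "stationary_law M \<eta> b a y \<nu> \<longleftrightarrow>
     prob_space \<nu> \<and> sets \<nu> = sets borel \<and>
     (\<forall>A\<in>sets borel. emeasure \<nu> A =
        (\<integral>\<^sup>+ v. emeasure M {\<omega>\<in>space M.
             Mmat \<eta> b (\<lambda>i. a i \<omega>) 1 *v v + qvec \<eta> b (\<lambda>i. a i \<omega>) (\<lambda>i. y i \<omega>) 1 \<in> A} \<partial>\<nu>))"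

definition couplings :: "'a::topological_space measure \<Rightarrow> 'a measure \<Rightarrow> ('a \<times> 'a) measure set" where
  "couplings \<nu>1 \<nu>2 = {\<pi>. prob_space \<pi> \<and> sets \<pi> = sets (borel \<Otimes>\<^sub>M borel) \<and>
       distr \<pi> borel fst = \<nu>1 \<and> distr \<pi> borel snd = \<nu>2}"

definition wasserstein :: "real \<Rightarrow> 'a::real_normed_vector measure \<Rightarrow> 'a measure \<Rightarrow> ennreal" where
  "wasserstein p \<nu>1 \<nu>2 =
     (let c = (INF \<pi>\<in>couplings \<nu>1 \<nu>2. \<integral>\<^sup>+ z. ennreal (norm (fst z - snd z) powr p) \<partial>\<pi>)
      in if c = \<infinity> then \<infinity> else ennreal (enn2real c powr (1 / p)))"

end

theory Submission
  imports Defs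
begin

text \<open>
  Gaussian features are rotation invariant, so the law of \<open>M\<^sub>1\<close> is invariant under orthogonal conjugation
  and \<open>E |M\<^sub>1 v|\<^sup>s = G(s) |v|\<^sup>s\<close> for all \<open>v\<close>, where \<open>G(s) = E |M\<^sub>1 e|\<^sup>s\<close> for any unit vector \<open>e\<close>.
  By independence \<open>E |\<Pi>\<^sub>k v|\<^sup>s = G(s)\<^sup>k |v|\<^sup>s\<close>, and comparing the spectral norm with the columns
  of \<open>\<Pi>\<^sub>k\<close> gives \<open>h = G\<close>. From \<open>G(\<alpha>) = 1\<close>, Young's inequality yields \<open>G(p) \<le> 1\<close>, and
  uniqueness of the tail index excludes equality. Driving both components of a coupling of
  \<open>\<nu>\<^sub>k\<close> and \<open>\<nu>\<^sub>\<infinity>\<close> by the same fresh batch yields a coupling of \<open>\<nu>\<^sub>k\<^sub>+\<^sub>1\<close> and \<open>\<nu>\<^sub>\<infinity>\<close>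
  whose cost is exactly \<open>G(p)\<close> times the old one.
\<close>

section \<open>Rotation invariance of Lebesgue measure and of Gaussian laws\<close>

lemma nn_integral_lborel_translation:
  fixes g :: "'a::euclidean_space \<Rightarrow> ennreal"
  assumes [measurable]: "g \<in> borel_measurable borel"
  shows "(\<integral>\<^sup>+x. g (t + x) \<partial>lborel) = (\<integral>\<^sup>+x. g x \<partial>lborel)"
    and "(\<integral>\<^sup>+x. g (t - x) \<partial>lborel) = (\<integral>\<^sup>+x. g x \<partial>lborel)"
proof -
  show "(\<integral>\<^sup>+x. g (t + x) \<partial>lborel) = (\<integral>\<^sup>+x. g x \<partial>lborel)"
    by (subst (2) lborel_affine[of 1 t]) (simp_all add: nn_integral_density nn_integral_distr)
  show "(\<integral>\<^sup>+x. g (t - x) \<partial>lborel) = (\<integral>\<^sup>+x. g x \<partial>lborel)"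
    by (subst (2) lborel_affine[of "-1" t]) (simp_all add: nn_integral_density nn_integral_distr)
qed

text \<open>An averaging argument: Fubini and translation invariance turn the volume of
  \<open>B\<close> times that of the preimage of \<open>A\<close> into the volume of the preimage of
  \<open>B\<close> times that of \<open>A\<close>. The unit ball \<open>B\<close> is its own
  preimage under \<open>f\<close>, so its volume cancels.\<close>

lemma distr_lborel_orthogonal_transformation:
  fixes f :: "'a::euclidean_space \<Rightarrow> 'a"
  assumes f: "orthogonal_transformation f"
  shows "distr lborel borel f = lborel"
proof (rule measure_eqI)
  have lin: "linear f" and nf: "norm (f x) = norm x" for x
    using f by (auto simp: orthogonal_transformation)
  then have [measurable]: "f \<in> borel_measurable borel"
    by (intro borel_measurable_continuous_onI linear_continuous_on linear_conv_bounded_linear[THEN iffD1])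
  obtain g where g: "\<And>x. f (g x) = x"
    using orthogonal_transformation_surj[OF f] by (metis surjD)
  fix A assume "A \<in> sets (distr lborel borel f)"
  then have [measurable]: "A \<in> sets borel" by simp
  define B where "B = ball (0::'a) 1"
  have [measurable]: "B \<in> sets borel" by (simp add: B_def)
  have B: "0 < emeasure lborel B" "emeasure lborel B < \<infinity>"
    unfolding B_def by (auto simp: emeasure_ball)
  define \<alpha> \<beta> :: "'a \<Rightarrow> ennreal" where "\<alpha> = indicator A" and "\<beta> = indicator B"
  have [measurable]: "\<alpha> \<in> borel_measurable borel" "\<beta> \<in> borel_measurable borel"
    by (simp_all add: \<alpha>_def \<beta>_def)
  have int: "emeasure lborel A = (\<integral>\<^sup>+x. \<alpha> x \<partial>lborel)" "emeasure lborel B = (\<integral>\<^sup>+x. \<beta> x \<partial>lborel)"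
    by (simp_all add: \<alpha>_def \<beta>_def)
  have "emeasure (distr lborel borel f) A = (\<integral>\<^sup>+x. \<alpha> x \<partial>distr lborel borel f)"
    by (simp add: \<alpha>_def)
  then have int_f: "emeasure (distr lborel borel f) A = (\<integral>\<^sup>+x. \<alpha> (f x) \<partial>lborel)"
    by (simp add: nn_integral_distr)
  have "emeasure lborel B * emeasure (distr lborel borel f) A
      = (\<integral>\<^sup>+y. \<beta> y * (\<integral>\<^sup>+x. \<alpha> (f x) \<partial>lborel) \<partial>lborel)"
    by (simp add: int int_f nn_integral_multc)
  \<comment> \<open>Translating \<open>x\<close> by the preimage \<open>g y\<close> of
    \<open>y\<close> leaves the inner integral unchanged and produces the argument
    \<open>y + f x\<close>, which couples the two variables.\<close>
  also have "\<dots> = (\<integral>\<^sup>+y. \<beta> y * (\<integral>\<^sup>+x. \<alpha> (f (g y + x)) \<partial>lborel) \<partial>lborel)"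
    using nn_integral_lborel_translation(1)[of "\<lambda>x. \<alpha> (f x)"] by simp
  also have "\<dots> = (\<integral>\<^sup>+y. (\<integral>\<^sup>+x. \<beta> y * \<alpha> (y + f x) \<partial>lborel) \<partial>lborel)"
    by (simp add: linear_add[OF lin] g nn_integral_cmult)
  also have "\<dots> = (\<integral>\<^sup>+x. (\<integral>\<^sup>+y. \<beta> y * \<alpha> (y + f x) \<partial>lborel) \<partial>lborel)"
    by (rule lborel_pair.Fubini') simp
  also have "\<dots> = (\<integral>\<^sup>+x. (\<integral>\<^sup>+y. \<beta> (y - f x) * \<alpha> y \<partial>lborel) \<partial>lborel)"
  proof (rule nn_integral_cong)
    fix x
    show "(\<integral>\<^sup>+y. \<beta> y * \<alpha> (y + f x) \<partial>lborel) = (\<integral>\<^sup>+y. \<beta> (y - f x) * \<alpha> y \<partial>lborel)"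
      using nn_integral_lborel_translation(1)[of "\<lambda>y. \<beta> y * \<alpha> (y + f x)" "- f x"] by simp
  qed
  also have "\<dots> = (\<integral>\<^sup>+y. (\<integral>\<^sup>+x. \<beta> (y - f x) * \<alpha> y \<partial>lborel) \<partial>lborel)"
    by (rule lborel_pair.Fubini'[symmetric]) simp
  \<comment> \<open>The same device in reverse: \<open>y - f x = f (g y - x)\<close>, and the
    substitution of \<open>g y - x\<close> by \<open>x\<close> removes \<open>y\<close> from the
    inner integral.\<close>
  also have "\<dots> = (\<integral>\<^sup>+y. (\<integral>\<^sup>+x. \<beta> (f (g y - x)) \<partial>lborel) * \<alpha> y \<partial>lborel)"
    by (simp add: linear_diff[OF lin] g nn_integral_multc)
  also have "\<dots> = (\<integral>\<^sup>+y. (\<integral>\<^sup>+x. \<beta> (f x) \<partial>lborel) * \<alpha> y \<partial>lborel)"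
    using nn_integral_lborel_translation(2)[of "\<lambda>x. \<beta> (f x)"] by simp
  also have "(\<lambda>x. \<beta> (f x)) = \<beta>"
    by (simp add: \<beta>_def B_def indicator_def nf fun_eq_iff)
  also have "(\<integral>\<^sup>+y. (\<integral>\<^sup>+x. \<beta> x \<partial>lborel) * \<alpha> y \<partial>lborel) = emeasure lborel B * emeasure lborel A"
    by (simp add: int nn_integral_cmult)
  finally show "emeasure (distr lborel borel f) A = emeasure lborel A"
    using B by (auto simp: ennreal_mult_cancel_left)
qed simp

text \<open>The exponents of the factors add up to the squared norm, so the density is
  radial.\<close>

lemma prod_normal_density_eq:
  fixes v :: "real^'d"
  shows "(\<Prod>j\<in>UNIV. normal_density 0 \<sigma> (v $ j))
     = (1 / sqrt (2 * pi * \<sigma>\<^sup>2)) ^ CARD('d) * exp (- (norm v)\<^sup>2 / (2 * \<sigma>\<^sup>2))"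
  by (simp add: normal_density_def prod.distrib exp_sum[symmetric] norm_vec_def L2_set_def
      sum_nonneg sum_divide_distrib sum_negf prod_dividef power_divide)

lemma distr_gaussian_orthogonal_transformation:
  fixes X :: "'w \<Rightarrow> real^'d"
  assumes X: "distributed M lborel X (\<lambda>v. ennreal (\<Prod>j\<in>UNIV. normal_density 0 \<sigma> (v $ j)))"
    and f: "orthogonal_transformation f"
  shows "distr M borel (\<lambda>\<omega>. f (X \<omega>)) = distr M borel X"
proof -
  define \<phi> where "\<phi> v = ennreal (\<Prod>j\<in>UNIV. normal_density 0 \<sigma> (v $ j))" for v :: "real^'d"
  have [measurable]: "f \<in> borel_measurable borel"
    using f by (intro borel_measurable_continuous_onI linear_continuous_on
      linear_conv_bounded_linear[THEN iffD1] orthogonal_transformation_linear)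
  have [measurable]: "\<phi> \<in> borel_measurable borel" "X \<in> borel_measurable M"
    using X by (auto simp: distributed_def \<phi>_def[abs_def])
  have inv: "\<phi> (f v) = \<phi> v" for v
    using f unfolding \<phi>_def prod_normal_density_eq by (simp add: orthogonal_transformation)
  have DX: "distr M borel X = density lborel \<phi>"
    using X unfolding distributed_def \<phi>_def[abs_def] by (metis distr_cong sets_lborel)
  have "distr M borel (\<lambda>\<omega>. f (X \<omega>)) = distr (distr M borel X) borel f"
    by (simp add: distr_distr comp_def)
  also have "\<dots> = distr (density lborel (\<lambda>v. \<phi> (f v))) borel f"
    by (simp add: DX inv)
  also have "\<dots> = density (distr lborel borel f) \<phi>"
    by (rule density_distr[symmetric]) simp_all
  also have "\<dots> = distr M borel X"
    by (simp add: DX distr_lborel_orthogonal_transformation[OF f])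
  finally show ?thesis .
qed

section \<open>The spectral norm: column bound and measurability\<close>

text \<open>Expand \<open>v\<close> in the standard basis and bound each coordinate by
  \<open>norm v\<close>. This reduces moments of the spectral norm to moments of the images of
  single unit vectors, which can be computed exactly.\<close>

lemma spec_norm_le_sum_columns:
  fixes A :: "real^'d^'d"
  shows "spec_norm A \<le> (\<Sum>j\<in>UNIV. norm (A *v axis j 1))"
  unfolding spec_norm_def
proof (rule onorm_le)
  fix v :: "real^'d"
  have "A *v v = (\<Sum>j\<in>UNIV. v $ j *\<^sub>R (A *v axis j 1))"
    by (subst matrix_mult_sum) (simp add: matrix_vector_mult_basis scalar_mult_eq_scaleR)
  also have "norm \<dots> \<le> (\<Sum>j\<in>UNIV. \<bar>v $ j\<bar> * norm (A *v axis j 1))"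
    by (rule order_trans[OF norm_sum]) simp
  also have "\<dots> \<le> (\<Sum>j\<in>UNIV. norm v * norm (A *v axis j 1))"
    by (intro sum_mono mult_right_mono component_le_norm_cart) auto
  finally show "norm (A *v v) \<le> (\<Sum>j\<in>UNIV. norm (A *v axis j 1)) * norm v"
    by (simp add: sum_distrib_left mult.commute)
qed

lemma norm_le_spec_norm: "norm (A *v v) \<le> spec_norm A * norm v"
  unfolding spec_norm_def by (rule onorm) (rule matrix_vector_mul_bounded_linear)

lemma spec_norm_nonneg: "0 \<le> spec_norm A"
  unfolding spec_norm_def by (rule onorm_pos_le) (rule matrix_vector_mul_bounded_linear)

text \<open>The sublevel sets of the norm are countable intersections over a dense set of test vectors.\<close>
lemma borel_measurable_spec_norm:
  fixes A :: "'w \<Rightarrow> real^'d^'d"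
  assumes A: "\<And>v. (\<lambda>\<omega>. A \<omega> *v v) \<in> borel_measurable M"
  shows "(\<lambda>\<omega>. spec_norm (A \<omega>)) \<in> borel_measurable M"
proof (rule borel_measurableI_le)
  fix c :: real
  obtain D :: "(real^'d) set" where D: "countable D" "\<And>X. open X \<Longrightarrow> X \<noteq> {} \<Longrightarrow> \<exists>d\<in>D. d \<in> X"
    by (rule countable_dense_setE) blast
  have dense: "closure D = UNIV"
  proof (rule ccontr)
    assume "closure D \<noteq> UNIV"
    then have "- closure D \<noteq> {}" by auto
    then obtain d where "d \<in> D" "d \<in> - closure D"
      using D(2)[of "- closure D"] by auto
    then show False
      using closure_subset[of D] by auto
  qed
  have le_iff: "spec_norm B \<le> c \<longleftrightarrow> 0 \<le> c \<and> (\<forall>v\<in>D. norm (B *v v) \<le> c * norm v)" for B :: "real^'d^'d"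
  proof
    assume *: "spec_norm B \<le> c"
    then have "norm (B *v v) \<le> c * norm v" for v
      using norm_le_spec_norm[of B v] mult_right_mono[OF *, of "norm v"] by simp
    then show "0 \<le> c \<and> (\<forall>v\<in>D. norm (B *v v) \<le> c * norm v)"
      using * spec_norm_nonneg[of B] by simp
  next
    assume *: "0 \<le> c \<and> (\<forall>v\<in>D. norm (B *v v) \<le> c * norm v)"
    have "closed {v. norm (B *v v) \<le> c * norm v}"
      by (intro closed_Collect_le continuous_intros linear_continuous_on matrix_vector_mul_bounded_linear)
    then have "closure D \<subseteq> {v. norm (B *v v) \<le> c * norm v}"
      using * by (intro closure_minimal) auto
    then show "spec_norm B \<le> c"
      unfolding spec_norm_def using dense by (intro onorm_le) auto
  qed
  note A[measurable]
  have "(\<lambda>\<omega>. 0 \<le> c \<and> (\<forall>v\<in>D. norm (A \<omega> *v v) \<le> c * norm v)) \<in> measurable M (count_space UNIV)"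
    using D(1) by measurable
  then show "{\<omega> \<in> space M. spec_norm (A \<omega>) \<le> c} \<in> sets M"
    unfolding le_iff by (rule predE)
qed

lemma powr_sum_le:
  fixes t :: "'i \<Rightarrow> real"
  assumes "finite I" "\<And>i. i \<in> I \<Longrightarrow> 0 \<le> t i" "0 < s"
  shows "(\<Sum>i\<in>I. t i) powr s \<le> real (card I) powr s * (\<Sum>i\<in>I. t i powr s)"
proof (cases "I = {}")
  case False
  define m where "m = Max (t ` I)"
  have "m \<in> t ` I"
    unfolding m_def using assms(1) False by (intro Max_in) auto
  then obtain i where i: "i \<in> I" "m = t i"
    by blast
  have "(\<Sum>i\<in>I. t i) \<le> (\<Sum>i\<in>I. m)"
    using assms by (intro sum_mono) (simp add: m_def)
  then have "(\<Sum>i\<in>I. t i) powr s \<le> (real (card I) * m) powr s"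
    using assms by (intro powr_mono2) (auto intro: sum_nonneg)
  also have "\<dots> = real (card I) powr s * t i powr s"
    using i assms by (simp add: powr_mult)
  also have "\<dots> \<le> real (card I) powr s * (\<Sum>i\<in>I. t i powr s)"
    using i assms by (intro mult_left_mono member_le_sum) auto
  finally show ?thesis .
qed simp

section \<open>One recursion step as a function of its batch\<close>

lemma Mmat_mult_vec:
  "Mmat \<eta> b a k *v v = v - (\<eta> / real b) *\<^sub>R (\<Sum>i\<in>batch b k. (a i \<bullet> v) *\<^sub>R a i)"
proof -
  have outer: "outer u u *v v = (u \<bullet> v) *\<^sub>R u" for u
    by (simp add: vec_eq_iff outer_def matrix_vector_mult_def inner_vec_def sum_distrib_left ac_simps)
  have "sum A I *v v = (\<Sum>i\<in>I. A i *v v)" for A :: "nat \<Rightarrow> real^'a^'a" and I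
    by (induction I rule: infinite_finite_induct) (simp_all add: matrix_vector_mult_add_rdistrib)
  then show ?thesis
    by (simp add: Mmat_def Hmat_def matrix_vector_mult_diff_rdistrib scaleR_matrix_vector_assoc[symmetric] outer)
qed

text \<open>Batches are reindexed by \<open>{1..b}\<close>, so that every step of the recursion is
  the same function applied to a shifted block of data. \<open>lin_step\<close> acts as the matrix,
  \<open>aff_step\<close> adds the inhomogeneous term.\<close>

definition lin_step :: "real \<Rightarrow> nat \<Rightarrow> (nat \<Rightarrow> real^'d) \<Rightarrow> real^'d \<Rightarrow> real^'d" where
  "lin_step \<eta> b n v = v - (\<eta> / real b) *\<^sub>R (\<Sum>i\<in>{1..b}. (n i \<bullet> v) *\<^sub>R n i)"

definition aff_step :: "real \<Rightarrow> nat \<Rightarrow> (nat \<Rightarrow> (real^'d) \<times> real) \<Rightarrow> real^'d \<Rightarrow> real^'d" where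
  "aff_step \<eta> b n v = lin_step \<eta> b (\<lambda>i. fst (n i)) v + (\<eta> / real b) *\<^sub>R (\<Sum>i\<in>{1..b}. snd (n i) *\<^sub>R fst (n i))"

text \<open>At \<open>Suc k\<close> the truncated subtraction in \<open>batch\<close> is exact, and
  the block consists of the indices \<open>b * k + 1\<close> to \<open>b * k + b\<close>.\<close>

lemma sum_batch_Suc: "(\<Sum>i\<in>batch b (Suc k). f i) = (\<Sum>i\<in>{1..b}. f (b * k + i))"
  using sum.shift_bounds_cl_nat_ivl[of f 1 "b * k" b]
  by (simp add: batch_def add.commute)

lemma Mmat_Suc_mult_vec: "Mmat \<eta> b a (Suc k) *v v = lin_step \<eta> b (\<lambda>i. a (b * k + i)) v"
  by (simp add: Mmat_mult_vec sum_batch_Suc lin_step_def)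

lemma Mmat_Suc_mult_vec_plus_qvec:
  "Mmat \<eta> b a (Suc k) *v v + qvec \<eta> b a y (Suc k) = aff_step \<eta> b (\<lambda>i. (a (b * k + i), y (b * k + i))) v"
  by (simp add: Mmat_Suc_mult_vec aff_step_def qvec_def sum_batch_Suc)

lemma lin_step_scaleR: "lin_step \<eta> b n (c *\<^sub>R v) = c *\<^sub>R lin_step \<eta> b n v"
  by (simp add: lin_step_def algebra_simps scaleR_sum_right)

text \<open>The inhomogeneous term cancels when both points see the same batch; this is what makes
  the synchronous coupling linear in the difference.\<close>

lemma aff_step_diff: "aff_step \<eta> b n u - aff_step \<eta> b n v = lin_step \<eta> b (\<lambda>i. fst (n i)) (u - v)"
  by (simp add: aff_step_def lin_step_def inner_diff_right scaleR_diff_left sum_subtractf algebra_simps)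

text \<open>\<open>lin_step\<close> is built from inner products and linear combinations, both
  respected by \<open>f\<close>. Hence rotating the features and the vector together leaves the norm
  of the result unchanged.\<close>

lemma lin_step_orthogonal_transformation:
  assumes "orthogonal_transformation f"
  shows "lin_step \<eta> b (\<lambda>i. f (n i)) (f v) = f (lin_step \<eta> b n v)"
proof -
  have "linear f" "\<And>u w. f u \<bullet> f w = u \<bullet> w"
    using assms by (auto simp: orthogonal_transformation_def)
  then show ?thesis
    by (simp add: lin_step_def linear_diff linear_scale linear_sum)
qed

lemma lin_step_restrict: "lin_step \<eta> b (restrict n {1..b}) v = lin_step \<eta> b n v"
  by (simp add: lin_step_def)

lemma aff_step_restrict: "aff_step \<eta> b (restrict n {1..b}) v = aff_step \<eta> b n v"
  by (simp add: aff_step_def lin_step_def)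

lemma borel_measurable_fst_snd_borel [measurable]:
  "fst \<in> borel \<rightarrow>\<^sub>M (borel :: 'a::second_countable_topology measure)"
  "snd \<in> borel \<rightarrow>\<^sub>M (borel :: 'b::second_countable_topology measure)"
  by (auto intro!: borel_measurable_continuous_onI continuous_intros)

lemma measurable_lin_step [measurable]:
  assumes [measurable]: "\<And>i. i \<in> {1..b} \<Longrightarrow> (\<lambda>\<omega>. n \<omega> i) \<in> borel_measurable N" "X \<in> borel_measurable N"
  shows "(\<lambda>\<omega>. lin_step \<eta> b (n \<omega>) (X \<omega>)) \<in> borel_measurable N"
  unfolding lin_step_def by measurable

lemma measurable_aff_step [measurable]:
  assumes [measurable]: "\<And>i. i \<in> {1..b} \<Longrightarrow> (\<lambda>\<omega>. n \<omega> i) \<in> borel_measurable N" "X \<in> borel_measurable N"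
  shows "(\<lambda>\<omega>. aff_step \<eta> b (n \<omega>) (X \<omega>)) \<in> borel_measurable N"
  unfolding aff_step_def by measurable

section \<open>Auxiliary facts on independence, root limits and powers\<close>

text \<open>The events of finitely many \<open>X j\<close> with \<open>j\<close> in \<open>I\<close>
  meet in one event of the sigma-algebra generated by the whole family, so \<open>indep\<close>
  splits off the factor for \<open>i\<close>. The collection \<open>F\<close> may be larger than the
  events of \<open>X i\<close>: in the application it is generated by \<open>x0\<close>, while the
  variable is \<open>(x0, 0)\<close>.\<close>

lemma (in prob_space) indep_vars_insert:
  assumes X: "indep_vars M' X I" and i: "i \<notin> I" and meas: "X i \<in> measurable M (M' i)"
    and F: "\<And>A. A \<in> sets (M' i) \<Longrightarrow> X i -` A \<inter> space M \<in> F"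
    and indep: "indep_set F (sets (vimage_algebra (space M) (\<lambda>\<omega>. \<lambda>j\<in>I. X j \<omega>) (PiM I M')))"
  shows "indep_vars M' X (insert i I)"
  unfolding indep_vars_def2
proof (intro conjI indep_setsI)
  let ?G = "\<lambda>j. {X j -` A \<inter> space M |A. A \<in> sets (M' j)}"
  have rv: "random_variable (M' j) (X j)" if "j \<in> insert i I" for j
    using X meas that by (auto simp: indep_vars_def2)
  show "\<forall>j\<in>insert i I. random_variable (M' j) (X j)"
    using rv by blast
  show "?G j \<subseteq> events" if "j \<in> insert i I" for j
    using rv[OF that] by (auto intro: measurable_sets)
  have indepX: "indep_sets ?G I"
    using X by (simp add: indep_vars_def2)
  fix A J assume J: "J \<noteq> {}" "J \<subseteq> insert i I" "finite J" and A: "\<forall>j\<in>J. A j \<in> ?G j"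
  show "prob (\<Inter>j\<in>J. A j) = (\<Prod>j\<in>J. prob (A j))"
  proof (cases "i \<in> J")
    case False
    then show ?thesis
      using J A by (intro indep_setsD[OF indepX]) auto
  next
    case True
    define K where "K = J - {i}"
    have K: "J = insert i K" "i \<notin> K" "finite K" "K \<subseteq> I"
      using True J by (auto simp: K_def)
    show ?thesis
    proof (cases "K = {}")
      case True
      then show ?thesis by (simp add: K)
    next
      case False
      have "\<forall>j\<in>K. \<exists>B. B \<in> sets (M' j) \<and> A j = X j -` B \<inter> space M"
        using A K by auto
      then obtain B where B: "\<And>j. j \<in> K \<Longrightarrow> B j \<in> sets (M' j)" "\<And>j. j \<in> K \<Longrightarrow> A j = X j -` B j \<inter> space M"
        by metis
      \<comment> \<open>The intersection is the preimage of a cylinder set; \<open>K\<close> is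
        nonempty, so it stays inside \<open>space M\<close>.\<close>
      have "(\<lambda>\<omega>. \<lambda>j\<in>I. X j \<omega>) -` prod_emb I M' K (Pi\<^sub>E K B) \<inter> space M = (\<Inter>j\<in>K. A j)"
      proof -
        have "X j \<omega> \<in> space (M' j)" if "j \<in> I" "\<omega> \<in> space M" for j \<omega>
          using rv[of j] that by (auto intro: measurable_space)
        moreover have "restrict (\<lambda>j\<in>I. X j \<omega>) K = restrict (\<lambda>j. X j \<omega>) K" for \<omega>
          using K(4) by (auto simp: restrict_def fun_eq_iff)
        ultimately show ?thesis
          using B(2) False by (auto simp: prod_emb_def PiE_iff)
      qed
      moreover have "prod_emb I M' K (Pi\<^sub>E K B) \<in> sets (PiM I M')"
        using K B by (intro sets_PiM_I) auto
      ultimately have "(\<Inter>j\<in>K. A j) \<in> sets (vimage_algebra (space M) (\<lambda>\<omega>. \<lambda>j\<in>I. X j \<omega>) (PiM I M'))"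
        using in_vimage_algebra by metis
      moreover have "A i \<in> F"
        using A F K by auto
      ultimately have "prob (A i \<inter> (\<Inter>j\<in>K. A j)) = prob (A i) * prob (\<Inter>j\<in>K. A j)"
        by (intro indep_setD[OF indep])
      also have "prob (\<Inter>j\<in>K. A j) = (\<Prod>j\<in>K. prob (A j))"
        using K A False by (intro indep_setsD[OF indepX]) auto
      finally show ?thesis
        using K by simp
    qed
  qed
qed

text \<open>The constant disappears in the limit because its \<open>k\<close>-th root tends to
  1.\<close>

lemma root_limit_of_geometric_bounds:
  fixes E :: "nat \<Rightarrow> real"
  assumes g: "0 \<le> g" and C: "0 < C" and lo: "\<And>k. g ^ k \<le> E k" and hi: "\<And>k. E k \<le> C * g ^ k"
  shows "(\<lambda>k. E k powr (1 / real k)) \<longlonglongrightarrow> g"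
proof (rule real_tendsto_sandwich)
  \<comment> \<open>The case \<open>k = 0\<close> is excluded because
    \<open>1 / real 0 = 0\<close>.\<close>
  have g_root: "(g ^ k) powr (1 / real k) = g" if "k > 0" for k
    using g that by (cases "g = 0") (simp_all add: powr_realpow[symmetric] powr_powr)
  show "\<forall>\<^sub>F k in sequentially. g \<le> E k powr (1 / real k)"
    using eventually_gt_at_top[of 0]
  proof eventually_elim
    case (elim k)
    then show ?case
      using g_root[OF elim] powr_mono2[OF _ _ lo[of k], of "1 / real k"] g by simp
  qed
  show "\<forall>\<^sub>F k in sequentially. E k powr (1 / real k) \<le> C powr (1 / real k) * g"
    using eventually_gt_at_top[of 0]
  proof eventually_elim
    case (elim k)
    have "0 \<le> E k"
      using lo[of k] g by (meson order_trans zero_le_power)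
    then show ?case
      using g_root[OF elim] powr_mono2[OF _ _ hi[of k], of "1 / real k"] g C by (simp add: powr_mult)
  qed
  have "(\<lambda>k. C powr (1 / real k) * g) \<longlonglongrightarrow> C powr 0 * g"
    using C by (intro tendsto_intros lim_1_over_n) auto
  then show "(\<lambda>k. C powr (1 / real k) * g) \<longlonglongrightarrow> g"
    using C by simp
qed simp

text \<open>Weighted arithmetic-geometric mean inequality for \<open>t powr q\<close> and 1, with
  weights \<open>p / q\<close> and \<open>1 - p / q\<close>.\<close>

lemma powr_le_convex_combination:
  fixes t :: real
  assumes "0 < p" "p < q" "0 \<le> t"
  shows "t powr p \<le> p / q * t powr q + (1 - p / q)"
proof (cases "t = 0")
  case False
  then show ?thesis
    using Youngs_inequality_0[of "p / q" "1 - p / q" "t powr q" 1] assms by (simp add: powr_powr)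
qed (use assms in simp)

section \<open>Isotropic data, batches and the growth of a single vector\<close>

text \<open>The initial value, paired with a dummy label 0, occupies index 0, so one independent
  family over all naturals holds both \<open>x0\<close> and the data. Of the Gaussian law,
  \<open>isotropic\<close> records the rotation invariance on which the argument rests.\<close>

locale isotropic_recursion = prob_space M for M :: "'w measure" +
  fixes a :: "nat \<Rightarrow> 'w \<Rightarrow> real^'d"
    and y :: "nat \<Rightarrow> 'w \<Rightarrow> real"
    and x0 :: "'w \<Rightarrow> real^'d"
    and b :: nat and \<eta> :: real
  assumes b: "b \<ge> 1"
    and meas_a [measurable]: "\<And>i. a i \<in> borel_measurable M"
    and meas_y [measurable]: "\<And>i. y i \<in> borel_measurable M"
    and meas_x0 [measurable]: "x0 \<in> borel_measurable M"
    and indep_data: "indep_vars (\<lambda>_. borel) (\<lambda>i \<omega>. if i = 0 then (x0 \<omega>, 0) else (a i \<omega>, y i \<omega>)) UNIV"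
    and ident: "\<And>i. i \<ge> 1 \<Longrightarrow>
        distr M borel (\<lambda>\<omega>. (a i \<omega>, y i \<omega>)) = distr M borel (\<lambda>\<omega>. (a 1 \<omega>, y 1 \<omega>))"
    and isotropic: "\<And>f. orthogonal_transformation f \<Longrightarrow> distr M borel (\<lambda>\<omega>. f (a 1 \<omega>)) = distr M borel (a 1)"
begin

declare One_nat_def [simp del]

definition data :: "nat \<Rightarrow> 'w \<Rightarrow> (real^'d) \<times> real" where
  "data i \<omega> = (if i = 0 then (x0 \<omega>, 0) else (a i \<omega>, y i \<omega>))"

text \<open>The index is shifted by one: \<open>noise k\<close> is the batch that drives step
  \<open>Suc k\<close>. The restriction makes it a point of \<open>noise_space\<close>.\<close>

definition noise :: "nat \<Rightarrow> 'w \<Rightarrow> nat \<Rightarrow> (real^'d) \<times> real" where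
  "noise k \<omega> = (\<lambda>i\<in>{1..b}. (a (b * k + i) \<omega>, y (b * k + i) \<omega>))"

abbreviation noise_space :: "(nat \<Rightarrow> (real^'d) \<times> real) measure" where
  "noise_space \<equiv> PiM {1..b} (\<lambda>_. borel)"

definition noise_law :: "(nat \<Rightarrow> (real^'d) \<times> real) measure" where
  "noise_law = distr M noise_space (noise 0)"

lemma sets_noise_law [measurable_cong, simp]: "sets noise_law = sets noise_space"
  by (simp add: noise_law_def)

lemma measurable_noise [measurable]: "noise k \<in> M \<rightarrow>\<^sub>M noise_space"
  unfolding noise_def by measurable

lemma prob_space_noise_law: "prob_space noise_law"
  unfolding noise_law_def by (rule prob_space_distr) measurable

lemma measurable_data [measurable]: "data i \<in> borel_measurable M"
  unfolding data_def by measurable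

lemma indep_vars_data: "indep_vars (\<lambda>_. borel) data UNIV"
  using indep_data by (simp add: data_def[abs_def])

lemma noise_eq: "noise k \<omega> = (\<lambda>i\<in>{1..b}. data (b * k + i) \<omega>)"
  by (auto simp: noise_def data_def)

lemma distr_data: "i \<ge> 1 \<Longrightarrow> distr M borel (data i) = distr M borel (data 1)"
  using ident[of i] by (simp add: data_def[abs_def])

text \<open>Reindexing passes through the disjoint singleton blocks \<open>{m + j}\<close>: the
  restrictions to them are independent, and evaluation at \<open>m + j\<close> recovers the
  variables.\<close>

lemma indep_vars_shift:
  "indep_vars (\<lambda>_. borel) (\<lambda>j. data (m + j)) {1..b}"
proof -
  have "indep_vars (\<lambda>j. PiM {m + j} (\<lambda>_. borel)) (\<lambda>j \<omega>. restrict (\<lambda>i. data i \<omega>) {m + j}) {1..b}"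
    by (rule indep_vars_restrict[OF indep_vars_data]) (auto simp: disjoint_family_on_def)
  then have "indep_vars (\<lambda>_. borel) (\<lambda>j \<omega>. restrict (\<lambda>i. data i \<omega>) {m + j} (m + j)) {1..b}"
    by (rule indep_vars_compose2) (auto intro: measurable_component_singleton)
  then show ?thesis by simp
qed

text \<open>By independence the law of a batch is a product measure, and by \<open>ident\<close> its
  factors do not depend on \<open>k\<close>.\<close>

lemma distr_noise: "distr M noise_space (noise k) = noise_law"
proof -
  have "distr M noise_space (noise k) = PiM {1..b} (\<lambda>i. distr M borel (data 1))" for k
  proof -
    have "distr M noise_space (\<lambda>\<omega>. \<lambda>i\<in>{1..b}. data (b * k + i) \<omega>)
        = PiM {1..b} (\<lambda>i. distr M borel (data (b * k + i)))"
      using b indep_vars_shift[of "b * k"] by (subst (asm) indep_vars_iff_distr_eq_PiM) auto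
    also have "\<dots> = PiM {1..b} (\<lambda>i. distr M borel (data 1))"
      by (intro PiM_cong refl distr_data) auto
    finally show ?thesis
      by (simp add: noise_eq[abs_def])
  qed
  from this[of k] this[of 0] show ?thesis
    by (simp add: noise_law_def)
qed

text \<open>Measurability with respect to \<open>x0\<close> and the first \<open>k\<close> batches,
  stated as a factorization through the data so that independence of the next batch transfers
  directly.\<close>

definition adapted :: "nat \<Rightarrow> 'a measure \<Rightarrow> ('w \<Rightarrow> 'a) \<Rightarrow> bool" where
  "adapted k N X \<longleftrightarrow> (\<exists>F \<in> PiM {..b * k} (\<lambda>_. borel) \<rightarrow>\<^sub>M N. X = (\<lambda>\<omega>. F (\<lambda>i\<in>{..b * k}. data i \<omega>)))"

lemma adapted_Suc:
  assumes X: "adapted k N X" and h: "(\<lambda>(n, x). h n x) \<in> noise_space \<Otimes>\<^sub>M N \<rightarrow>\<^sub>M L"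
  shows "adapted (Suc k) L (\<lambda>\<omega>. h (noise k \<omega>) (X \<omega>))"
proof -
  obtain F where F [measurable]: "F \<in> PiM {..b * k} (\<lambda>_. borel) \<rightarrow>\<^sub>M N"
    and X_eq: "X = (\<lambda>\<omega>. F (\<lambda>i\<in>{..b * k}. data i \<omega>))"
    using X unfolding adapted_def by blast
  have [measurable]: "(\<lambda>z. \<lambda>i\<in>{..b * k}. z i) \<in> PiM {..b * Suc k} (\<lambda>_. borel) \<rightarrow>\<^sub>M PiM {..b * k} (\<lambda>_. borel)"
    by (intro measurable_restrict measurable_component_singleton) auto
  have [measurable]: "(\<lambda>z. \<lambda>i\<in>{1..b}. z (b * k + i)) \<in> PiM {..b * Suc k} (\<lambda>_. borel) \<rightarrow>\<^sub>M noise_space"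
    by (intro measurable_restrict measurable_component_singleton) auto
  have "(\<lambda>z. (\<lambda>(n, x). h n x) (\<lambda>i\<in>{1..b}. z (b * k + i), F (\<lambda>i\<in>{..b * k}. z i))) \<in> PiM {..b * Suc k} (\<lambda>_. borel) \<rightarrow>\<^sub>M L"
    by (rule measurable_compose[OF _ h]) measurable
  moreover have "(\<lambda>\<omega>. h (noise k \<omega>) (X \<omega>)) = (\<lambda>\<omega>. (\<lambda>z. (\<lambda>(n, x). h n x)
      (\<lambda>i\<in>{1..b}. z (b * k + i), F (\<lambda>i\<in>{..b * k}. z i))) (\<lambda>i\<in>{..b * Suc k}. data i \<omega>))"
    by (simp add: X_eq noise_eq cong: restrict_cong)
  ultimately show ?thesis
    unfolding adapted_def by (intro bexI)
qed

lemma adapted_measurable: "adapted k N X \<Longrightarrow> X \<in> M \<rightarrow>\<^sub>M N"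
  unfolding adapted_def by (auto intro!: measurable_compose[OF measurable_restrict])

lemma adapted_const: "c \<in> space N \<Longrightarrow> adapted k N (\<lambda>_. c)"
  unfolding adapted_def by (rule bexI[of _ "\<lambda>_. c"]) auto

lemma adapted_x0: "adapted 0 borel x0"
  unfolding adapted_def
proof (rule bexI[of _ "\<lambda>z. fst (z 0)"])
  have "(\<lambda>z. z 0) \<in> PiM {..b * 0} (\<lambda>_. borel) \<rightarrow>\<^sub>M (borel :: ((real^'d) \<times> real) measure)"
    by (rule measurable_component_singleton) simp
  then show "(\<lambda>z. fst (z 0)) \<in> PiM {..b * 0} (\<lambda>_. borel :: ((real^'d) \<times> real) measure) \<rightarrow>\<^sub>M borel"
    by measurable
qed (simp add: data_def)

text \<open>\<open>X\<close> and \<open>noise k\<close> are functions of the data on disjoint index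
  sets, hence independent. The product form of the joint law lets expectations over one step be
  computed by integrating out the fresh batch first.\<close>

lemma distr_adapted_noise:
  assumes X: "adapted k N X"
  shows "distr M (N \<Otimes>\<^sub>M noise_space) (\<lambda>\<omega>. (X \<omega>, noise k \<omega>)) = distr M N X \<Otimes>\<^sub>M noise_law"
proof -
  obtain F where F: "F \<in> PiM {..b * k} (\<lambda>_. borel) \<rightarrow>\<^sub>M N"
    and X_eq: "X = (\<lambda>\<omega>. F (\<lambda>i\<in>{..b * k}. data i \<omega>))"
    using X unfolding adapted_def by blast
  have "indep_var (PiM {..b * k} (\<lambda>_. borel)) (\<lambda>\<omega>. \<lambda>i\<in>{..b * k}. data i \<omega>)
      (PiM {b * k + 1..b * k + b} (\<lambda>_. borel)) (\<lambda>\<omega>. \<lambda>i\<in>{b * k + 1..b * k + b}. data i \<omega>)"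
    by (rule indep_var_restrict[OF indep_vars_data]) auto
  moreover have "(\<lambda>z. \<lambda>i\<in>{1..b}. z (b * k + i)) \<in> PiM {b * k + 1..b * k + b} (\<lambda>_. borel) \<rightarrow>\<^sub>M noise_space"
    by (intro measurable_restrict measurable_component_singleton) auto
  ultimately have "indep_var (PiM {..b * k} (\<lambda>_. borel)) (id \<circ> (\<lambda>\<omega>. \<lambda>i\<in>{..b * k}. data i \<omega>)) noise_space
      ((\<lambda>z. \<lambda>i\<in>{1..b}. z (b * k + i)) \<circ> (\<lambda>\<omega>. \<lambda>i\<in>{b * k + 1..b * k + b}. data i \<omega>))"
    by (intro indep_var_compose) auto
  moreover have "(\<lambda>z. \<lambda>i\<in>{1..b}. z (b * k + i)) \<circ> (\<lambda>\<omega>. \<lambda>i\<in>{b * k + 1..b * k + b}. data i \<omega>) = noise k"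
    by (auto simp: noise_eq fun_eq_iff)
  ultimately have "indep_var (PiM {..b * k} (\<lambda>_. borel)) (\<lambda>\<omega>. \<lambda>i\<in>{..b * k}. data i \<omega>) noise_space (noise k)"
    by simp
  then have joint: "distr M (PiM {..b * k} (\<lambda>_. borel)) (\<lambda>\<omega>. \<lambda>i\<in>{..b * k}. data i \<omega>) \<Otimes>\<^sub>M noise_law
      = distr M (PiM {..b * k} (\<lambda>_. borel) \<Otimes>\<^sub>M noise_space) (\<lambda>\<omega>. (\<lambda>i\<in>{..b * k}. data i \<omega>, noise k \<omega>))"
    by (simp only: indep_var_distribution_eq distr_noise)
  interpret N: prob_space noise_law by (rule prob_space_noise_law)
  note F [measurable]
  \<comment> \<open>\<open>pair_measure_distr\<close> takes both factors as image measures, so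
    \<open>noise_law\<close> is written as its own image under the identity.\<close>
  have id_law: "distr noise_law noise_space (\<lambda>n. n) = noise_law"
    by (rule distr_id2) simp
  have X_law: "distr M N X = distr (distr M (PiM {..b * k} (\<lambda>_. borel)) (\<lambda>\<omega>. \<lambda>i\<in>{..b * k}. data i \<omega>)) N F"
    unfolding X_eq by (subst distr_distr) (auto simp: comp_def)
  have "distr M N X \<Otimes>\<^sub>M noise_law
      = distr (distr M (PiM {..b * k} (\<lambda>_. borel)) (\<lambda>\<omega>. \<lambda>i\<in>{..b * k}. data i \<omega>) \<Otimes>\<^sub>M noise_law)
          (N \<Otimes>\<^sub>M noise_space) (\<lambda>(z, n). (F z, n))"
    unfolding X_law by (subst id_law[symmetric], rule pair_measure_distr)
      (simp_all add: id_law N.sigma_finite_measure_axioms)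
  also have "\<dots> = distr M (N \<Otimes>\<^sub>M noise_space) (\<lambda>\<omega>. (X \<omega>, noise k \<omega>))"
    unfolding joint X_eq by (subst distr_distr) (auto simp: comp_def)
  finally show ?thesis ..
qed

lemma measurable_fst_snd_component [measurable]:
  assumes "i \<in> {1..b}"
  shows "(\<lambda>z. snd z i) \<in> N \<Otimes>\<^sub>M noise_space \<rightarrow>\<^sub>M borel" "(\<lambda>z. fst z i) \<in> noise_space \<Otimes>\<^sub>M N \<rightarrow>\<^sub>M borel"
  using assms by (auto intro!: measurable_compose[OF measurable_snd measurable_component_singleton]
      measurable_compose[OF measurable_fst measurable_component_singleton])

lemma measurable_lin_step_noise:
  "(\<lambda>z. lin_step \<eta> b (\<lambda>i. fst (snd z i)) (fst z)) \<in> borel \<Otimes>\<^sub>M noise_space \<rightarrow>\<^sub>M borel"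
  by (intro measurable_lin_step measurable_compose[OF measurable_fst_snd_component(1) borel_measurable_fst_snd_borel(1)]
      measurable_fst)

lemma measurable_aff_step_noise:
  "(\<lambda>z. aff_step \<eta> b (snd z) (fst z)) \<in> borel \<Otimes>\<^sub>M noise_space \<rightarrow>\<^sub>M borel"
  by (intro measurable_aff_step measurable_fst_snd_component(1) measurable_fst)

text \<open>This is \<open>G(s)\<close>, with an arbitrary coordinate vector as the unit vector and
  \<infinity> as a possible value.\<close>

definition moment :: "real \<Rightarrow> ennreal" where
  "moment s = (\<integral>\<^sup>+n. ennreal (norm (lin_step \<eta> b (\<lambda>i. fst (n i)) (axis undefined 1)) powr s) \<partial>noise_law)"

lemma distr_rotated_features:
  assumes f: "orthogonal_transformation f"
  shows "distr M (PiM {1..b} (\<lambda>_. borel)) (\<lambda>\<omega>. \<lambda>i\<in>{1..b}. f (a i \<omega>))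
       = distr M (PiM {1..b} (\<lambda>_. borel)) (\<lambda>\<omega>. \<lambda>i\<in>{1..b}. a i \<omega>)"
proof -
  \<comment> \<open>The law after any orthogonal map is the same product measure; comparing
    \<open>f\<close> with the identity gives the claim.\<close>
  have law: "distr M (PiM {1..b} (\<lambda>_. borel)) (\<lambda>\<omega>. \<lambda>i\<in>{1..b}. g (a i \<omega>)) = PiM {1..b} (\<lambda>_. distr M borel (a 1))"
    if g: "orthogonal_transformation g" for g
  proof -
    have [measurable]: "g \<in> borel_measurable borel"
      using g by (intro borel_measurable_continuous_onI linear_continuous_on
        linear_conv_bounded_linear[THEN iffD1] orthogonal_transformation_linear)
    have "indep_vars (\<lambda>_. borel) (\<lambda>i \<omega>. g (fst (data (0 + i) \<omega>))) {1..b}"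
      by (rule indep_vars_compose2[OF indep_vars_shift]) measurable
    then have "indep_vars (\<lambda>_. borel) (\<lambda>i \<omega>. g (a i \<omega>)) {1..b}"
      by (rule indep_vars_cong[THEN iffD1, rotated -1]) (auto simp: data_def)
    then have "distr M (PiM {1..b} (\<lambda>_. borel)) (\<lambda>\<omega>. \<lambda>i\<in>{1..b}. g (a i \<omega>))
        = PiM {1..b} (\<lambda>i. distr M borel (\<lambda>\<omega>. g (a i \<omega>)))"
      using b by (subst (asm) indep_vars_iff_distr_eq_PiM) auto
    also have "\<dots> = PiM {1..b} (\<lambda>_. distr M borel (a 1))"
    proof (intro PiM_cong refl)
      fix i assume "i \<in> {1..b}"
      have "distr M borel (\<lambda>\<omega>. g (a j \<omega>)) = distr (distr M borel (\<lambda>\<omega>. (a j \<omega>, y j \<omega>))) borel (\<lambda>z. g (fst z))" for j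
        by (subst distr_distr) (auto simp: comp_def)
      then show "distr M borel (\<lambda>\<omega>. g (a i \<omega>)) = distr M borel (a 1)"
        using ident[of i] \<open>i \<in> {1..b}\<close> isotropic[OF g] by simp
    qed
    finally show ?thesis .
  qed
  show ?thesis
    using law[OF f] law[OF orthogonal_transformation_id] by (simp add: id_def)
qed

text \<open>A rotation taking the reference vector to a given unit vector can be applied to the
  features as well without changing their law, so all unit vectors have the same moment. Homogeneity
  extends this to every \<open>v\<close>.\<close>

lemma nn_integral_norm_lin_step:
  "(\<integral>\<^sup>+n. ennreal (norm (lin_step \<eta> b (\<lambda>i. fst (n i)) v) powr s) \<partial>noise_law) = ennreal (norm v powr s) * moment s"
proof -
  let ?e = "axis undefined 1 :: real^'d"
  let ?A = "PiM {1..b} (\<lambda>_. borel :: (real^'d) measure)"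
  define I where "I u = (\<integral>\<^sup>+n. ennreal (norm (lin_step \<eta> b (\<lambda>i. fst (n i)) u) powr s) \<partial>noise_law)" for u
  have I_eq: "I u = (\<integral>\<^sup>+n. ennreal (norm (lin_step \<eta> b n u) powr s) \<partial>distr M ?A (\<lambda>\<omega>. \<lambda>i\<in>{1..b}. a i \<omega>))" for u
  proof -
    have "I u = (\<integral>\<^sup>+\<omega>. ennreal (norm (lin_step \<eta> b (\<lambda>i. fst (noise 0 \<omega> i)) u) powr s) \<partial>M)"
      unfolding I_def noise_law_def by (rule nn_integral_distr) measurable
    also have "\<dots> = (\<integral>\<^sup>+\<omega>. ennreal (norm (lin_step \<eta> b (\<lambda>i\<in>{1..b}. a i \<omega>) u) powr s) \<partial>M)"
      by (simp add: noise_def lin_step_def)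
    also have "\<dots> = (\<integral>\<^sup>+n. ennreal (norm (lin_step \<eta> b n u) powr s) \<partial>distr M ?A (\<lambda>\<omega>. \<lambda>i\<in>{1..b}. a i \<omega>))"
      by (rule nn_integral_distr[symmetric]) measurable
    finally show ?thesis .
  qed
  have I_unit: "I u = moment s" if u: "norm u = 1" for u
  proof -
    obtain f where f: "orthogonal_transformation f" "f ?e = u"
      using orthogonal_transformation_exists_1[OF norm_axis_1 u] by blast
    have [measurable]: "f \<in> borel_measurable borel"
      using f by (intro borel_measurable_continuous_onI linear_continuous_on
        linear_conv_bounded_linear[THEN iffD1] orthogonal_transformation_linear)
    have "I u = (\<integral>\<^sup>+n. ennreal (norm (lin_step \<eta> b n u) powr s) \<partial>distr M ?A (\<lambda>\<omega>. \<lambda>i\<in>{1..b}. f (a i \<omega>)))"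
      by (simp only: I_eq distr_rotated_features[OF f(1)])
    also have "\<dots> = (\<integral>\<^sup>+\<omega>. ennreal (norm (lin_step \<eta> b (\<lambda>i\<in>{1..b}. f (a i \<omega>)) (f ?e)) powr s) \<partial>M)"
      unfolding f(2) by (rule nn_integral_distr) measurable
    also have "\<dots> = (\<integral>\<^sup>+\<omega>. ennreal (norm (lin_step \<eta> b (\<lambda>i\<in>{1..b}. a i \<omega>) ?e) powr s) \<partial>M)"
      using f(1) by (simp only: lin_step_restrict lin_step_orthogonal_transformation[OF f(1)] orthogonal_transformation)
    also have "\<dots> = I ?e"
      unfolding I_eq by (rule nn_integral_distr[symmetric]) measurable
    finally show ?thesis
      by (simp add: I_def moment_def)
  qed
  have "I v = ennreal (norm v powr s) * moment s"
  proof (cases "v = 0")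
    \<comment> \<open>Both sides vanish, since \<open>0 powr s = 0\<close> for every
      \<open>s\<close>.\<close>
    case True
    then show ?thesis by (simp add: I_def lin_step_def)
  next
    case False
    define u where "u = v /\<^sub>R norm v"
    have v: "v = norm v *\<^sub>R u" and u: "norm u = 1"
      using False by (auto simp: u_def)
    have "I v = (\<integral>\<^sup>+n. ennreal (norm v powr s) * ennreal (norm (lin_step \<eta> b (\<lambda>i. fst (n i)) u) powr s) \<partial>noise_law)"
      unfolding I_def by (subst v) (simp add: lin_step_scaleR powr_mult ennreal_mult)
    also have "\<dots> = ennreal (norm v powr s) * I u"
      unfolding I_def by (rule nn_integral_cmult) measurable
    finally show ?thesis
      by (simp add: I_unit[OF u])
  qed
  then show ?thesis
    by (simp add: I_def)
qed

lemma nn_integral_norm_lin_step_adapted: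
  assumes X: "adapted k borel X"
  shows "(\<integral>\<^sup>+\<omega>. ennreal (norm (lin_step \<eta> b (\<lambda>i. fst (noise k \<omega> i)) (X \<omega>)) powr s) \<partial>M)
       = moment s * (\<integral>\<^sup>+\<omega>. ennreal (norm (X \<omega>) powr s) \<partial>M)"
proof -
  interpret N: prob_space noise_law by (rule prob_space_noise_law)
  have [measurable]: "X \<in> borel_measurable M"
    using X by (rule adapted_measurable)
  have m: "(\<lambda>z. ennreal (norm (lin_step \<eta> b (\<lambda>i. fst (snd z i)) (fst z)) powr s)) \<in> borel_measurable (borel \<Otimes>\<^sub>M noise_space)"
    by (rule measurable_compose[OF measurable_lin_step_noise]) measurable
  have "(\<integral>\<^sup>+\<omega>. ennreal (norm (lin_step \<eta> b (\<lambda>i. fst (noise k \<omega> i)) (X \<omega>)) powr s) \<partial>M)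
      = (\<integral>\<^sup>+z. ennreal (norm (lin_step \<eta> b (\<lambda>i. fst (snd z i)) (fst z)) powr s)
          \<partial>distr M (borel \<Otimes>\<^sub>M noise_space) (\<lambda>\<omega>. (X \<omega>, noise k \<omega>)))"
    using m by (subst nn_integral_distr) simp_all
  also have "\<dots> = (\<integral>\<^sup>+z. ennreal (norm (lin_step \<eta> b (\<lambda>i. fst (snd z i)) (fst z)) powr s)
          \<partial>(distr M borel X \<Otimes>\<^sub>M noise_law))"
    by (simp only: distr_adapted_noise[OF X])
  also have "\<dots> = (\<integral>\<^sup>+x. \<integral>\<^sup>+n. ennreal (norm (lin_step \<eta> b (\<lambda>i. fst (n i)) x) powr s) \<partial>noise_law \<partial>distr M borel X)"
    using m by (subst N.nn_integral_fst[symmetric]) (simp_all cong: measurable_cong_sets)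
  also have "\<dots> = (\<integral>\<^sup>+x. ennreal (norm x powr s) * moment s \<partial>distr M borel X)"
    by (simp only: nn_integral_norm_lin_step)
  also have "\<dots> = moment s * (\<integral>\<^sup>+\<omega>. ennreal (norm (X \<omega>) powr s) \<partial>M)"
    by (simp add: nn_integral_distr nn_integral_multc mult.commute)
  finally show ?thesis .
qed

lemma Piprod_Suc_mult_vec:
  "Piprod \<eta> b (\<lambda>i. a i \<omega>) (Suc k) *v v = lin_step \<eta> b (\<lambda>i. fst (noise k \<omega> i)) (Piprod \<eta> b (\<lambda>i. a i \<omega>) k *v v)"
  by (simp add: matrix_vector_mul_assoc[symmetric] Mmat_Suc_mult_vec noise_def lin_step_def)

lemma xseq_Suc:
  "xseq \<eta> b (\<lambda>i. a i \<omega>) (\<lambda>i. y i \<omega>) v (Suc k) = aff_step \<eta> b (noise k \<omega>) (xseq \<eta> b (\<lambda>i. a i \<omega>) (\<lambda>i. y i \<omega>) v k)"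
  by (simp add: Mmat_Suc_mult_vec_plus_qvec noise_def aff_step_restrict)

lemma adapted_Piprod: "adapted k borel (\<lambda>\<omega>. Piprod \<eta> b (\<lambda>i. a i \<omega>) k *v v)"
proof (induction k)
  case 0
  show ?case by (simp add: adapted_const)
next
  case (Suc k)
  show ?case
    unfolding Piprod_Suc_mult_vec
    by (rule adapted_Suc[OF Suc, of "\<lambda>n. lin_step \<eta> b (\<lambda>i. fst (n i))"]) simp
qed

lemma adapted_xseq: "adapted k borel (\<lambda>\<omega>. xseq \<eta> b (\<lambda>i. a i \<omega>) (\<lambda>i. y i \<omega>) (x0 \<omega>) k)"
proof (induction k)
  case 0
  show ?case by (simp add: adapted_x0)
next
  case (Suc k)
  show ?case
    unfolding xseq_Suc by (rule adapted_Suc[OF Suc]) simp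
qed

text \<open>Each factor uses a fresh batch and contributes exactly \<open>moment s\<close>, whatever
  the direction reached so far.\<close>

lemma nn_integral_norm_Piprod:
  "(\<integral>\<^sup>+\<omega>. ennreal (norm (Piprod \<eta> b (\<lambda>i. a i \<omega>) k *v v) powr s) \<partial>M) = ennreal (norm v powr s) * moment s ^ k"
proof (induction k)
  case 0
  show ?case by (simp add: emeasure_space_1)
next
  case (Suc k)
  show ?case
    unfolding Piprod_Suc_mult_vec nn_integral_norm_lin_step_adapted[OF adapted_Piprod] Suc
    by (simp add: mult_ac)
qed

end

section \<open>Identification of \<open>h\<close> with the one-step moment\<close>

context isotropic_recursion
begin

lemma measurable_spec_norm_Piprod [measurable]:
  "(\<lambda>\<omega>. spec_norm (Piprod \<eta> b (\<lambda>i. a i \<omega>) k)) \<in> borel_measurable M"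
  by (intro borel_measurable_spec_norm adapted_measurable[OF adapted_Piprod])

lemma moment_power_le_nn_integral_spec_norm:
  assumes "0 < s"
  shows "moment s ^ k \<le> (\<integral>\<^sup>+\<omega>. ennreal (spec_norm (Piprod \<eta> b (\<lambda>i. a i \<omega>) k) powr s) \<partial>M)"
proof -
  let ?e = "axis undefined 1 :: real^'d"
  have "moment s ^ k = (\<integral>\<^sup>+\<omega>. ennreal (norm (Piprod \<eta> b (\<lambda>i. a i \<omega>) k *v ?e) powr s) \<partial>M)"
    by (simp add: nn_integral_norm_Piprod norm_axis_1)
  also have "\<dots> \<le> (\<integral>\<^sup>+\<omega>. ennreal (spec_norm (Piprod \<eta> b (\<lambda>i. a i \<omega>) k) powr s) \<partial>M)"
    using norm_le_spec_norm[of _ ?e] assms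
    by (intro nn_integral_mono ennreal_leI powr_mono2) (simp_all add: norm_axis_1)
  finally show ?thesis .
qed

text \<open>Sum the exact moments of the columns; the constant does not depend on \<open>k\<close>,
  so it is lost under the \<open>k\<close>-th root.\<close>

lemma nn_integral_spec_norm_le_moment_power:
  assumes "0 < s"
  shows "(\<integral>\<^sup>+\<omega>. ennreal (spec_norm (Piprod \<eta> b (\<lambda>i. a i \<omega>) k) powr s) \<partial>M)
    \<le> ennreal (real CARD('d) powr s * real CARD('d)) * moment s ^ k"
proof -
  let ?P = "\<lambda>\<omega>. Piprod \<eta> b (\<lambda>i. a i \<omega>) k"
  have [measurable]: "(\<lambda>\<omega>. ?P \<omega> *v v) \<in> borel_measurable M" for v
    by (rule adapted_measurable[OF adapted_Piprod])
  have "(\<integral>\<^sup>+\<omega>. ennreal (spec_norm (?P \<omega>) powr s) \<partial>M)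
    \<le> (\<integral>\<^sup>+\<omega>. ennreal (real CARD('d) powr s) * (\<Sum>j\<in>UNIV. ennreal (norm (?P \<omega> *v axis j 1) powr s)) \<partial>M)"
  proof (intro nn_integral_mono)
    fix \<omega>
    have "spec_norm (?P \<omega>) powr s \<le> (\<Sum>j\<in>UNIV. norm (?P \<omega> *v axis j 1)) powr s"
      using assms by (intro powr_mono2 spec_norm_le_sum_columns spec_norm_nonneg) auto
    also have "\<dots> \<le> real CARD('d) powr s * (\<Sum>j\<in>UNIV. norm (?P \<omega> *v axis j 1) powr s)"
      using assms by (intro powr_sum_le) auto
    finally show "ennreal (spec_norm (?P \<omega>) powr s)
        \<le> ennreal (real CARD('d) powr s) * (\<Sum>j\<in>UNIV. ennreal (norm (?P \<omega> *v axis j 1) powr s))"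
      by (simp add: sum_nonneg ennreal_leI flip: ennreal_mult)
  qed
  also have "\<dots> = ennreal (real CARD('d) powr s) * (\<Sum>j\<in>(UNIV :: 'd set). moment s ^ k)"
    by (simp add: nn_integral_cmult nn_integral_sum nn_integral_norm_Piprod norm_axis_1 del: sum_ennreal)
  also have "\<dots> = ennreal (real CARD('d) powr s * real CARD('d)) * moment s ^ k"
    by (simp add: ennreal_mult mult.assoc ennreal_of_nat_eq_real_of_nat)
  finally show ?thesis .
qed

lemma hfun_eq_moment:
  assumes s: "0 < s" and g: "moment s = ennreal g" "0 \<le> g"
  shows "hfun M \<eta> b a s = g"
proof -
  define C where "C = real CARD('d) powr s * real CARD('d)"
  have C: "0 < C" by (simp add: C_def)
  define E where "E k = (\<integral>\<omega>. spec_norm (Piprod \<eta> b (\<lambda>i. a i \<omega>) k) powr s \<partial>M)" for k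
  have bounds: "g ^ k \<le> E k \<and> E k \<le> C * g ^ k" for k
  proof -
    let ?N = "\<integral>\<^sup>+\<omega>. ennreal (spec_norm (Piprod \<eta> b (\<lambda>i. a i \<omega>) k) powr s) \<partial>M"
    have hi: "?N \<le> ennreal (C * g ^ k)"
      using nn_integral_spec_norm_le_moment_power[OF s, of k] g C
      by (simp add: C_def ennreal_mult ennreal_power)
    have lo: "ennreal (g ^ k) \<le> ?N"
      using moment_power_le_nn_integral_spec_norm[OF s, of k] g by (simp add: ennreal_power)
    \<comment> \<open>The upper bound makes the expectation finite, so the Bochner integral in
      \<open>hfun\<close> agrees with the nonnegative integral.\<close>
    have "integrable M (\<lambda>\<omega>. spec_norm (Piprod \<eta> b (\<lambda>i. a i \<omega>) k) powr s)"
      using hi by (intro integrableI_bounded) (auto simp: le_less_trans ennreal_less_top)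
    then have "?N = ennreal (E k)"
      unfolding E_def by (rule nn_integral_eq_integral) simp
    moreover have "0 \<le> E k"
      by (simp add: E_def)
    ultimately show ?thesis
      using hi lo g C by (simp add: ennreal_le_iff)
  qed
  have "(\<lambda>k. E k powr (1 / real k)) \<longlonglongrightarrow> g"
    using bounds by (intro root_limit_of_geometric_bounds[OF g(2) C]) auto
  then show ?thesis
    unfolding hfun_def E_def by (rule limI)
qed

text \<open>Here the expectations in the definition of h are infinite, so the Bochner integral takes its junk value 0.\<close>
lemma hfun_eq_0_if_moment_infinite:
  assumes s: "0 < s" and "moment s = \<infinity>"
  shows "hfun M \<eta> b a s = 0"
proof -
  have "\<forall>\<^sub>F k in sequentially. (\<integral>\<omega>. spec_norm (Piprod \<eta> b (\<lambda>i. a i \<omega>) k) powr s \<partial>M) powr (1 / real k) = 0"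
    using eventually_gt_at_top[of 0]
  proof eventually_elim
    case (elim k)
    have "(\<integral>\<^sup>+\<omega>. ennreal (spec_norm (Piprod \<eta> b (\<lambda>i. a i \<omega>) k) powr s) \<partial>M) = \<infinity>"
      using moment_power_le_nn_integral_spec_norm[OF s, of k] assms(2) elim
      by (simp add: power_top_ennreal top_unique)
    then have "\<not> integrable M (\<lambda>\<omega>. spec_norm (Piprod \<eta> b (\<lambda>i. a i \<omega>) k) powr s)"
      by (auto simp: real_integrable_def)
    then show ?case
      by (simp add: not_integrable_integral_eq)
  qed
  then show ?thesis
    unfolding hfun_def by (intro limI tendsto_eventually)
qed

section \<open>Comparison of moments of different exponents\<close>

lemma moment_measurable: "(\<lambda>n. lin_step \<eta> b (\<lambda>i. fst (n i)) v) \<in> borel_measurable noise_law"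
  by (intro measurable_lin_step measurable_compose[OF _ borel_measurable_fst_snd_borel(1)])
    (auto cong: measurable_cong_sets intro: measurable_component_singleton)

lemma moment_le_1:
  assumes "0 < p" "p < q" "moment q = 1"
  shows "moment p \<le> 1"
proof -
  interpret N: prob_space noise_law by (rule prob_space_noise_law)
  note moment_measurable[measurable]
  let ?t = "\<lambda>n. norm (lin_step \<eta> b (\<lambda>i. fst (n i)) (axis undefined 1 :: real^'d))"
  have "moment p \<le> (\<integral>\<^sup>+n. ennreal (p / q) * ennreal (?t n powr q) + ennreal (1 - p / q) \<partial>noise_law)"
    unfolding moment_def
  proof (intro nn_integral_mono)
    fix n :: "nat \<Rightarrow> (real^'d) \<times> real"
    show "ennreal (?t n powr p) \<le> ennreal (p / q) * ennreal (?t n powr q) + ennreal (1 - p / q)"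
      using powr_le_convex_combination[of p q "?t n"] assms
      by (simp add: ennreal_leI flip: ennreal_mult ennreal_plus)
  qed
  also have "\<dots> = ennreal (p / q) * moment q + ennreal (1 - p / q)"
    unfolding moment_def by (simp add: nn_integral_add nn_integral_cmult N.emeasure_space_1)
  also have "\<dots> = 1"
    using assms by (simp flip: ennreal_plus)
  finally show ?thesis .
qed

text \<open>A zero moment means that the step annihilates the reference vector almost surely, a
  condition free of the exponent. With \<open>moment \<alpha> = 1\<close> this yields
  \<open>moment p > 0\<close>.\<close>

lemma moment_eq_0:
  assumes "moment p = 0"
  shows "moment q = 0"
proof -
  note moment_measurable[measurable]
  have "AE n in noise_law. lin_step \<eta> b (\<lambda>i. fst (n i)) (axis undefined 1) = 0"
    using assms unfolding moment_def by (subst (asm) nn_integral_0_iff_AE) auto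
  then show ?thesis
    unfolding moment_def by (subst nn_integral_0_iff_AE) auto
qed

section \<open>Contraction of the transport cost and of the Wasserstein distance\<close>

text \<open>The \<open>p\<close>-th power of \<open>wasserstein p\<close>, kept without the root so
  that one step scales it by \<open>moment p\<close> itself.\<close>

definition transport_cost :: "real \<Rightarrow> (real^'d) measure \<Rightarrow> (real^'d) measure \<Rightarrow> ennreal" where
  "transport_cost p \<mu> \<nu> = (INF \<pi>\<in>couplings \<mu> \<nu>. \<integral>\<^sup>+ z. ennreal (norm (fst z - snd z) powr p) \<partial>\<pi>)"

text \<open>The Markov operator of the recursion acting on laws.\<close>

definition push_law :: "(real^'d) measure \<Rightarrow> (real^'d) measure" where
  "push_law \<mu> = distr (\<mu> \<Otimes>\<^sub>M noise_law) borel (\<lambda>z. aff_step \<eta> b (snd z) (fst z))"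

lemma push_law_xseq:
  "distr M borel (\<lambda>\<omega>. xseq \<eta> b (\<lambda>i. a i \<omega>) (\<lambda>i. y i \<omega>) (x0 \<omega>) (Suc k))
    = push_law (distr M borel (\<lambda>\<omega>. xseq \<eta> b (\<lambda>i. a i \<omega>) (\<lambda>i. y i \<omega>) (x0 \<omega>) k))"
proof -
  note adapted_measurable[OF adapted_xseq, measurable]
  show ?thesis
    unfolding push_law_def xseq_Suc distr_adapted_noise[OF adapted_xseq, symmetric]
    using measurable_aff_step_noise by (subst distr_distr) (auto simp: comp_def)
qed

text \<open>\<open>stationary_law\<close> integrates the one-step transition probabilities over
  \<open>\<nu>\<close>; slicing the product measure in \<open>push_law\<close> at a fixed state
  gives the same integral.\<close>

lemma push_law_stationary:
  assumes "stationary_law M \<eta> b a y \<nu>"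
  shows "push_law \<nu> = \<nu>"
proof (rule measure_eqI)
  have \<nu>: "sets \<nu> = sets borel" "prob_space \<nu>"
    using assms by (auto simp: stationary_law_def)
  interpret \<nu>: prob_space \<nu> by fact
  interpret N: prob_space noise_law by (rule prob_space_noise_law)
  note \<nu>(1)[measurable_cong]
  show "sets (push_law \<nu>) = sets \<nu>"
    by (simp add: push_law_def \<nu>)
  fix A assume "A \<in> sets (push_law \<nu>)"
  then have A: "A \<in> sets borel" by (simp add: push_law_def)
  have m: "(\<lambda>z. aff_step \<eta> b (snd z) (fst z)) \<in> \<nu> \<Otimes>\<^sub>M noise_law \<rightarrow>\<^sub>M borel"
    using measurable_aff_step_noise by (simp add: \<nu> cong: measurable_cong_sets sets_pair_measure_cong)
  have mv: "(\<lambda>n. aff_step \<eta> b n v) \<in> noise_space \<rightarrow>\<^sub>M borel" for v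
    by (intro measurable_aff_step measurable_component_singleton) auto
  have "emeasure (push_law \<nu>) A = emeasure (\<nu> \<Otimes>\<^sub>M noise_law) ((\<lambda>z. aff_step \<eta> b (snd z) (fst z)) -` A \<inter> space (\<nu> \<Otimes>\<^sub>M noise_law))"
    unfolding push_law_def using m A by (rule emeasure_distr)
  also have "\<dots> = (\<integral>\<^sup>+v. emeasure noise_law (Pair v -` ((\<lambda>z. aff_step \<eta> b (snd z) (fst z)) -` A \<inter> space (\<nu> \<Otimes>\<^sub>M noise_law))) \<partial>\<nu>)"
    by (rule N.emeasure_pair_measure_alt[OF measurable_sets[OF m A]])
  also have "\<dots> = (\<integral>\<^sup>+v. emeasure M {\<omega>\<in>space M. Mmat \<eta> b (\<lambda>i. a i \<omega>) 1 *v v + qvec \<eta> b (\<lambda>i. a i \<omega>) (\<lambda>i. y i \<omega>) 1 \<in> A} \<partial>\<nu>)"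
  proof (rule nn_integral_cong)
    fix v assume v: "v \<in> space \<nu>"
    have pre: "Pair v -` ((\<lambda>z. aff_step \<eta> b (snd z) (fst z)) -` A \<inter> space (\<nu> \<Otimes>\<^sub>M noise_law))
        = (\<lambda>n. aff_step \<eta> b n v) -` A \<inter> space noise_space"
      using v by (auto simp: space_pair_measure noise_law_def)
    have "noise 0 -` ((\<lambda>n. aff_step \<eta> b n v) -` A \<inter> space noise_space) \<inter> space M
        = {\<omega>\<in>space M. aff_step \<eta> b (noise 0 \<omega>) v \<in> A}"
      using measurable_space[OF measurable_noise] by auto
    \<comment> \<open>Batch 1 of the recursion is \<open>noise 0\<close>.\<close>
    also have "\<dots> = {\<omega>\<in>space M. Mmat \<eta> b (\<lambda>i. a i \<omega>) 1 *v v + qvec \<eta> b (\<lambda>i. a i \<omega>) (\<lambda>i. y i \<omega>) 1 \<in> A}"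
      using Mmat_Suc_mult_vec_plus_qvec[of \<eta> b "\<lambda>i. a i _" 0 v] by (simp add: noise_def aff_step_restrict One_nat_def[symmetric])
    finally have event: "noise 0 -` ((\<lambda>n. aff_step \<eta> b n v) -` A \<inter> space noise_space) \<inter> space M
        = {\<omega>\<in>space M. Mmat \<eta> b (\<lambda>i. a i \<omega>) 1 *v v + qvec \<eta> b (\<lambda>i. a i \<omega>) (\<lambda>i. y i \<omega>) 1 \<in> A}" .
    have "emeasure noise_law B = emeasure M (noise 0 -` B \<inter> space M)" if "B \<in> sets noise_space" for B
      unfolding noise_law_def using that by (intro emeasure_distr) simp_all
    from this[OF measurable_sets[OF mv A]]
    show "emeasure noise_law (Pair v -` ((\<lambda>z. aff_step \<eta> b (snd z) (fst z)) -` A \<inter> space (\<nu> \<Otimes>\<^sub>M noise_law)))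
      = emeasure M {\<omega>\<in>space M. Mmat \<eta> b (\<lambda>i. a i \<omega>) 1 *v v + qvec \<eta> b (\<lambda>i. a i \<omega>) (\<lambda>i. y i \<omega>) 1 \<in> A}"
      by (simp only: pre event)
  qed
  also have "\<dots> = emeasure \<nu> A"
    using assms A by (simp add: stationary_law_def)
  finally show "emeasure (push_law \<nu>) A = emeasure \<nu> A" .
qed

lemma transport_cost_push_law_le:
  assumes g: "moment p = ennreal g" "0 < g"
  shows "transport_cost p (push_law \<mu>) (push_law \<nu>) \<le> ennreal g * transport_cost p \<mu> \<nu>"
proof -
  interpret N: prob_space noise_law by (rule prob_space_noise_law)
  \<comment> \<open>With the factor \<open>g\<close> moved to the left, the infimum on the right can
    be treated one coupling at a time.\<close>
  have "transport_cost p (push_law \<mu>) (push_law \<nu>) / ennreal g \<le> transport_cost p \<mu> \<nu>"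
    unfolding transport_cost_def[of p \<mu>]
  proof (rule INF_greatest)
    fix \<pi> assume "\<pi> \<in> couplings \<mu> \<nu>"
    then have \<pi>: "prob_space \<pi>" "sets \<pi> = sets (borel \<Otimes>\<^sub>M borel)"
      "distr \<pi> borel fst = \<mu>" "distr \<pi> borel snd = \<nu>"
      by (auto simp: couplings_def)
    interpret \<pi>: prob_space \<pi> by fact
    interpret \<pi>N: pair_prob_space \<pi> noise_law ..
    note \<pi>(2)[measurable_cong]
    \<comment> \<open>The synchronous coupling: both components are moved by the same batch,
      independent of \<open>\<pi>\<close>.\<close>
    define T where "T z = (aff_step \<eta> b (snd z) (fst (fst z)), aff_step \<eta> b (snd z) (snd (fst z)))"
      for z :: "((real^'d) \<times> (real^'d)) \<times> (nat \<Rightarrow> (real^'d) \<times> real)"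
    have m: "(\<lambda>z. aff_step \<eta> b (snd z) (h (fst z))) \<in> \<pi> \<Otimes>\<^sub>M noise_law \<rightarrow>\<^sub>M borel"
      if h: "h \<in> \<pi> \<rightarrow>\<^sub>M borel" for h
    proof (rule measurable_aff_step)
      show "(\<lambda>z. h (fst z)) \<in> \<pi> \<Otimes>\<^sub>M noise_law \<rightarrow>\<^sub>M borel"
        using h by (rule measurable_compose[OF measurable_fst])
      show "(\<lambda>z. snd z i) \<in> \<pi> \<Otimes>\<^sub>M noise_law \<rightarrow>\<^sub>M borel" if "i \<in> {1..b}" for i
        using measurable_fst_snd_component(1)[OF that, of \<pi>]
        by (simp cong: measurable_cong_sets sets_pair_measure_cong)
    qed
    have fs: "fst \<in> \<pi> \<rightarrow>\<^sub>M borel" "snd \<in> \<pi> \<rightarrow>\<^sub>M borel"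
      by measurable
    have T: "T \<in> \<pi> \<Otimes>\<^sub>M noise_law \<rightarrow>\<^sub>M borel \<Otimes>\<^sub>M borel"
      unfolding T_def[abs_def] by (intro measurable_Pair m fs)
    \<comment> \<open>Used for \<open>h = fst\<close> and \<open>h = snd\<close>: each component on
      its own sees an independent batch, so sharing it does not affect the marginals.\<close>
    have marg: "distr (\<pi> \<Otimes>\<^sub>M noise_law) borel (\<lambda>z. aff_step \<eta> b (snd z) (h (fst z))) = push_law (distr \<pi> borel h)"
      if h: "h \<in> \<pi> \<rightarrow>\<^sub>M borel" for h
    proof -
      have id_law: "distr noise_law noise_space (\<lambda>n. n) = noise_law"
        by (rule distr_id2) simp
      have "distr \<pi> borel h \<Otimes>\<^sub>M noise_law = distr (\<pi> \<Otimes>\<^sub>M noise_law) (borel \<Otimes>\<^sub>M noise_space) (\<lambda>(z, n). (h z, n))"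
        using h by (subst id_law[symmetric], subst pair_measure_distr)
          (simp_all add: id_law N.sigma_finite_measure_axioms)
      then show ?thesis
        unfolding push_law_def using h measurable_aff_step_noise
        by (simp add: distr_distr comp_def case_prod_beta)
    qed
    define \<pi>' where "\<pi>' = distr (\<pi> \<Otimes>\<^sub>M noise_law) (borel \<Otimes>\<^sub>M borel) T"
    have "prob_space \<pi>'"
      unfolding \<pi>'_def by (rule \<pi>N.prob_space_distr[OF T])
    moreover have "distr \<pi>' borel fst = push_law \<mu>" "distr \<pi>' borel snd = push_law \<nu>"
      unfolding \<pi>'_def using T marg[OF fs(1)] marg[OF fs(2)]
      by (simp_all add: distr_distr comp_def T_def \<pi>)
    ultimately have "\<pi>' \<in> couplings (push_law \<mu>) (push_law \<nu>)"
      by (auto simp: couplings_def \<pi>'_def)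
    then have "transport_cost p (push_law \<mu>) (push_law \<nu>) \<le> (\<integral>\<^sup>+ z. ennreal (norm (fst z - snd z) powr p) \<partial>\<pi>')"
      unfolding transport_cost_def by (rule INF_lower)
    also have "\<dots> = (\<integral>\<^sup>+ z. ennreal (norm (fst (T z) - snd (T z)) powr p) \<partial>(\<pi> \<Otimes>\<^sub>M noise_law))"
      unfolding \<pi>'_def using T by (rule nn_integral_distr) measurable
    also have "\<dots> = (\<integral>\<^sup>+ x. \<integral>\<^sup>+ n. ennreal (norm (fst (T (x, n)) - snd (T (x, n))) powr p) \<partial>noise_law \<partial>\<pi>)"
      by (intro N.nn_integral_fst[symmetric] measurable_compose[OF T]) measurable
    also have "\<dots> = (\<integral>\<^sup>+ x. ennreal (norm (fst x - snd x) powr p) * moment p \<partial>\<pi>)"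
      by (simp add: T_def aff_step_diff nn_integral_norm_lin_step)
    also have "\<dots> = (\<integral>\<^sup>+ x. ennreal (norm (fst x - snd x) powr p) \<partial>\<pi>) * ennreal g"
      unfolding g by (rule nn_integral_multc) measurable
    finally show "transport_cost p (push_law \<mu>) (push_law \<nu>) / ennreal g \<le> (\<integral>\<^sup>+ z. ennreal (norm (fst z - snd z) powr p) \<partial>\<pi>)"
      using g by (intro divide_le_posI_ennreal) (simp_all add: mult.commute)
  qed
  then have "ennreal g * (transport_cost p (push_law \<mu>) (push_law \<nu>) / ennreal g) \<le> ennreal g * transport_cost p \<mu> \<nu>"
    by (rule mult_left_mono) simp
  moreover have "ennreal g * (c / ennreal g) = c" for c
    using g ennreal_mult_divide_eq[of "ennreal g" c] by (simp add: ennreal_times_divide mult.commute[of "ennreal g"])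
  ultimately show ?thesis
    by simp
qed

text \<open>Each step multiplies the cost by at most \<open>g\<close>, while the second law stays
  fixed by stationarity.\<close>

lemma transport_cost_xseq_le:
  assumes g: "moment p = ennreal g" "0 < g" and stat: "stationary_law M \<eta> b a y \<nu>"
  shows "transport_cost p (distr M borel (\<lambda>\<omega>. xseq \<eta> b (\<lambda>i. a i \<omega>) (\<lambda>i. y i \<omega>) (x0 \<omega>) k)) \<nu>
    \<le> ennreal (g ^ k) * transport_cost p (distr M borel x0) \<nu>"
proof (induction k)
  case 0
  show ?case by simp
next
  case (Suc k)
  show ?case
    unfolding push_law_xseq
    using transport_cost_push_law_le[OF g, of "distr M borel (\<lambda>\<omega>. xseq \<eta> b (\<lambda>i. a i \<omega>) (\<lambda>i. y i \<omega>) (x0 \<omega>) k)" \<nu>]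
      mult_left_mono[OF Suc, of "ennreal g"] g
    by (auto simp: push_law_stationary[OF stat] ennreal_mult mult.assoc intro: order_trans)
qed

lemma wasserstein_xseq_le:
  assumes p: "0 < p" and g: "moment p = ennreal g" "0 < g" and stat: "stationary_law M \<eta> b a y \<nu>"
  shows "wasserstein p (distr M borel (\<lambda>\<omega>. xseq \<eta> b (\<lambda>i. a i \<omega>) (\<lambda>i. y i \<omega>) (x0 \<omega>) k)) \<nu>
    \<le> ennreal (g powr (real k / p)) * wasserstein p (distr M borel x0) \<nu>"
proof -
  let ?W = "\<lambda>c. if c = \<infinity> then \<infinity> else ennreal (enn2real c powr (1 / p))"
  have W: "wasserstein p \<mu> \<nu> = ?W (transport_cost p \<mu> \<nu>)" for \<mu>
    by (simp add: wasserstein_def transport_cost_def Let_def)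
  define c0 ck where "c0 = transport_cost p (distr M borel x0) \<nu>"
    and "ck = transport_cost p (distr M borel (\<lambda>\<omega>. xseq \<eta> b (\<lambda>i. a i \<omega>) (\<lambda>i. y i \<omega>) (x0 \<omega>) k)) \<nu>"
  have le: "ck \<le> ennreal (g ^ k) * c0"
    unfolding c0_def ck_def by (rule transport_cost_xseq_le[OF g stat])
  have "?W ck \<le> ennreal (g powr (real k / p)) * ?W c0"
  proof (cases "c0 = \<infinity>")
    \<comment> \<open>The right-hand side is infinite because the factor
      \<open>g powr (real k / p)\<close> is positive.\<close>
    case True
    then show ?thesis
      using g by (simp add: ennreal_mult_top)
  next
    case False
    then obtain r where r: "c0 = ennreal r" "0 \<le> r"
      by (cases c0) auto
    have le': "ck \<le> ennreal (g ^ k * r)"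
      using le r g by (simp add: ennreal_mult)
    then obtain t where t: "ck = ennreal t" "0 \<le> t"
      by (cases ck) (auto simp: top_unique)
    have "t \<le> g ^ k * r"
      using le' t g r by (simp add: ennreal_le_iff)
    then have "t powr (1 / p) \<le> (g ^ k * r) powr (1 / p)"
      using t p by (intro powr_mono2) auto
    also have "\<dots> = g powr (real k / p) * r powr (1 / p)"
      using g r by (simp add: powr_mult powr_powr flip: powr_realpow)
    finally show ?thesis
      using t r by (simp add: ennreal_leI flip: ennreal_mult)
  qed
  then show ?thesis
    by (simp only: W c0_def ck_def)
qed

end

section \<open>Specialization to Gaussian features\<close>

theorem theorem6:
  fixes M :: "'w measure"
    and a :: "nat \<Rightarrow> 'w \<Rightarrow> real^'d"
    and y :: "nat \<Rightarrow> 'w \<Rightarrow> real"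
    and x0 :: "'w \<Rightarrow> real^'d"
    and b :: nat and \<eta> \<sigma> \<alpha> p :: real
    and f :: "real \<Rightarrow> real"
    and \<nu>inf :: "(real^'d) measure"
  assumes "prob_space M"
    and b: "b \<ge> 1" and eta: "\<eta> > 0"
    \<comment> \<open>i.i.d. data (a_i, y_i), i \<ge> 1, and x_0 independent of the data\<close>
    and meas_a: "\<And>i. a i \<in> borel_measurable M"
    and meas_y: "\<And>i. y i \<in> borel_measurable M"
    and meas_x0: "x0 \<in> borel_measurable M"
    and indep: "prob_space.indep_vars M (\<lambda>_. borel) (\<lambda>i \<omega>. (a i \<omega>, y i \<omega>)) {1..}"
    and ident: "\<And>i. i \<ge> 1 \<Longrightarrow>
        distr M borel (\<lambda>\<omega>. (a i \<omega>, y i \<omega>)) = distr M borel (\<lambda>\<omega>. (a 1 \<omega>, y 1 \<omega>))"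
    and indep_x0: "prob_space.indep_set M (sets (vimage_algebra (space M) x0 borel))
        (sets (vimage_algebra (space M) (\<lambda>\<omega>. \<lambda>i\<in>{1::nat..}. (a i \<omega>, y i \<omega>))
                 (PiM {1..} (\<lambda>_. borel))))"
    \<comment> \<open>(A2): y_i with continuous density supported on R, all moments finite\<close>
    and f_cont: "continuous_on UNIV f" and f_nonneg: "\<And>t. f t \<ge> 0"
    and f_supp: "closure {t. f t > 0} = UNIV"
    and y_dens: "\<And>i. i \<ge> 1 \<Longrightarrow> distributed M lborel (y i) (\<lambda>t. ennreal (f t))"
    and y_mom: "\<And>i n. i \<ge> 1 \<Longrightarrow> integrable M (\<lambda>\<omega>. \<bar>y i \<omega>\<bar> ^ n)"
    \<comment> \<open>(A3): a_i ~ N(0, \<sigma>^2 I_d)\<close>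
    and sigma: "\<sigma> > 0"
    and a_gauss: "\<And>i. i \<ge> 1 \<Longrightarrow> distributed M lborel (a i)
                   (\<lambda>v. ennreal (\<Prod>j\<in>UNIV. normal_density 0 \<sigma> (v $ j)))"
    \<comment> \<open>top Lyapunov exponent \<rho> < 0\<close>
    and rho: "\<exists>\<rho><0. AE \<omega> in M.
        (\<lambda>k. ln (lambda_max (transpose (Piprod \<eta> b (\<lambda>i. a i \<omega>) k) ** Piprod \<eta> b (\<lambda>i. a i \<omega>) k))
              / (2 * real k)) \<longlonglongrightarrow> \<rho>"
    \<comment> \<open>tail-index \<alpha>: the unique \<alpha> > 0 with h(\<alpha>) = 1; and \<alpha> > 1\<close>
    and alpha_pos: "\<alpha> > 0"
    and h_alpha: "hfun M \<eta> b a \<alpha> = 1"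
    and alpha_unique: "\<And>s. s > 0 \<Longrightarrow> hfun M \<eta> b a s = 1 \<Longrightarrow> s = \<alpha>"
    and alpha_gt1: "\<alpha> > 1"
    \<comment> \<open>\<nu>_\<infinity>: law of the stationary solution\<close>
    and stat: "stationary_law M \<eta> b a y \<nu>inf"
    \<comment> \<open>1 \<le> p < \<alpha>, \<nu>_0 with finite p-th moment\<close>
    and p: "1 \<le> p" "p < \<alpha>"
    and x0_mom: "integrable M (\<lambda>\<omega>. norm (x0 \<omega>) powr p)"
  shows "0 < hfun M \<eta> b a p powr (1 / p) \<and> hfun M \<eta> b a p powr (1 / p) < 1 \<and>
         (\<forall>k. wasserstein p (distr M borel (\<lambda>\<omega>. xseq \<eta> b (\<lambda>i. a i \<omega>) (\<lambda>i. y i \<omega>) (x0 \<omega>) k)) \<nu>inf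
              \<le> ennreal (hfun M \<eta> b a p powr (real k / p)) * wasserstein p (distr M borel x0) \<nu>inf)"
proof -
  interpret prob_space M by fact
  note [measurable] = meas_a meas_y meas_x0
  have "indep_vars (\<lambda>_. borel) (\<lambda>i \<omega>. if i = 0 then (x0 \<omega>, 0) else (a i \<omega>, y i \<omega>)) (insert 0 {1..})"
  proof (rule indep_vars_insert)
    show "indep_vars (\<lambda>_. borel) (\<lambda>i \<omega>. if i = 0 then (x0 \<omega>, 0) else (a i \<omega>, y i \<omega>)) {1..}"
      by (rule indep_vars_cong[THEN iffD1, OF _ _ _ indep]) auto
    have eq: "(\<lambda>\<omega>. \<lambda>i\<in>{1..}. if i = 0 then (x0 \<omega>, 0) else (a i \<omega>, y i \<omega>)) = (\<lambda>\<omega>. \<lambda>i\<in>{1..}. (a i \<omega>, y i \<omega>))"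
      by (auto simp: restrict_def fun_eq_iff)
    show "indep_set (sets (vimage_algebra (space M) x0 borel))
        (sets (vimage_algebra (space M) (\<lambda>\<omega>. \<lambda>i\<in>{1..}. if i = 0 then (x0 \<omega>, 0) else (a i \<omega>, y i \<omega>)) (PiM {1..} (\<lambda>_. borel))))"
      unfolding eq by (rule indep_x0)
    fix A :: "((real^'d) \<times> real) set" assume A: "A \<in> sets borel"
    \<comment> \<open>Appending the constant 0 is a Borel map, so the events of
      \<open>(x0, 0)\<close> lie in the sigma-algebra generated by \<open>x0\<close>.\<close>
    have "(\<lambda>v :: real^'d. (v, 0 :: real)) \<in> borel \<rightarrow>\<^sub>M borel"
      by measurable
    then have "(\<lambda>v. (v, 0)) -` A \<inter> space borel \<in> sets (borel :: (real^'d) measure)"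
      using A by (rule measurable_sets)
    from in_vimage_algebra[OF this, of x0 "space M"]
    show "(\<lambda>\<omega>. if (0::nat) = 0 then (x0 \<omega>, 0) else (a 0 \<omega>, y 0 \<omega>)) -` A \<inter> space M \<in> sets (vimage_algebra (space M) x0 borel)"
      by (simp add: vimage_def)
  qed simp_all
  moreover have "insert 0 {1..} = (UNIV :: nat set)"
    by auto
  ultimately have indep_all: "indep_vars (\<lambda>_. borel) (\<lambda>i \<omega>. if i = 0 then (x0 \<omega>, 0) else (a i \<omega>, y i \<omega>)) UNIV"
    by (simp only:)
  interpret isotropic_recursion M a y x0 b \<eta>
  proof unfold_locales
    show "distr M borel (\<lambda>\<omega>. f (a 1 \<omega>)) = distr M borel (a 1)" if "orthogonal_transformation f" for f
      using that by (intro distr_gaussian_orthogonal_transformation[OF a_gauss]) simp_all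
  qed (fact b meas_a meas_y meas_x0 indep_all ident)+
  have p_pos: "0 < p" using p by simp
  \<comment> \<open>An infinite moment would make \<open>hfun\<close> equal to 0 at \<alpha> instead
    of 1.\<close>
  have "moment \<alpha> \<noteq> \<infinity>"
    using hfun_eq_0_if_moment_infinite[OF alpha_pos] h_alpha by auto
  then obtain r where "moment \<alpha> = ennreal r" "0 \<le> r"
    by (cases "moment \<alpha>") auto
  with hfun_eq_moment[OF alpha_pos this] h_alpha have m_alpha: "moment \<alpha> = 1"
    by simp
  have m_p: "moment p \<le> 1"
    using p_pos p(2) m_alpha by (rule moment_le_1)
  then obtain g where g: "moment p = ennreal g" "0 \<le> g"
    by (cases "moment p") (auto simp: top_unique)
  have h_p: "hfun M \<eta> b a p = g"
    using hfun_eq_moment[OF p_pos g] .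
  have "g \<noteq> 0"
    using moment_eq_0[of p \<alpha>] g m_alpha by auto
  then have g_pos: "0 < g"
    using g by simp
  have "g \<le> 1"
    using m_p g by simp
  \<comment> \<open>Otherwise \<open>p\<close> would solve \<open>h(p) = 1\<close>, and uniqueness
    of the tail index would force \<open>p = \<alpha>\<close>.\<close>
  moreover have "g \<noteq> 1"
    using alpha_unique[OF p_pos] h_p p by auto
  ultimately have "g powr (1 / p) < 1"
    using g_pos p_pos powr_less_mono2[of "1 / p" g 1] by simp
  then show ?thesis
    unfolding h_p using g_pos wasserstein_xseq_le[OF p_pos g(1) g_pos stat] by simp
qed

end
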